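(* Let $\mathcal{F}_S$ denote the class of graphs containing a spanning star, that is, a vertex connected to all other vertices in the graph. Then we have $$M_{\mathcal{F}_S}(n)=\begin{cases} n+1 & \text{if } n \text{ is odd},\\ n & \text{if } n \text{ is even}.\end{cases}$$
   Context: All graphs are finite and simple. For two graphs $G,G'$ on the vertex set $[n]=\{1,\dots,n\}$, $G\oplus G'$ denotes the graph on $[n]$ whose edge set is the symmetric difference of $E(G)$ and $E(G')$. For a class $\mathcal{F}$ of graphs, a family $\mathcal{G}$ of (labeled) graphs on vertex set $[n]$ is called $\mathcal{F}$-good if $G\oplus G'\in\mathcal{F}$ for any two distinct members $G,G'\in\mathcal{G}$. $M_{\mathcal{F}}(n)$ denotes the maximum possible size of an $\mathcal{F}$-good family on vertex set $[n]$.
   Formalization: The formula is proved for n ≥ 2; for n = 1 there is only one graph on [n], so the maximum is 1 and not n+1 = 2, and for n = 0 it is 1 and not 0. *)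

theory Defs
  imports Main
begin

type_synonym 'a graph = "'a set \<times> 'a set set"

abbreviation verts :: "'a graph \<Rightarrow> 'a set" where
  "verts G \<equiv> fst G"

abbreviation edges :: "'a graph \<Rightarrow> 'a set set" where
  "edges G \<equiv> snd G"

definition simple_graph :: "'a graph \<Rightarrow> bool" where
  "simple_graph G \<longleftrightarrow>
     finite (verts G) \<and> (\<forall>e \<in> edges G. e \<subseteq> verts G \<and> card e = 2)"

definition labeled_graphs :: "nat \<Rightarrow> nat graph set" where
  "labeled_graphs n = {G. simple_graph G \<and> verts G = {1..n}}"

(* Only used for two graphs on the same vertex set; taking the union of the
   vertex sets is an arbitrary totalisation. *)
definition graph_symdiff :: "'a graph \<Rightarrow> 'a graph \<Rightarrow> 'a graph" (infixl "\<oplus>" 65) where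
  "G \<oplus> H = (verts G \<union> verts H, (edges G - edges H) \<union> (edges H - edges G))"

definition good_family :: "nat graph set \<Rightarrow> nat \<Rightarrow> nat graph set \<Rightarrow> bool" where
  "good_family F n \<G> \<longleftrightarrow>
     \<G> \<subseteq> labeled_graphs n \<and> (\<forall>G \<in> \<G>. \<forall>H \<in> \<G>. G \<noteq> H \<longrightarrow> G \<oplus> H \<in> F)"

definition max_good :: "nat graph set \<Rightarrow> nat \<Rightarrow> nat" where
  "max_good F n = Max {card \<G> | \<G>. good_family F n \<G>}"

definition spanning_star_graphs :: "'a graph set" where
  "spanning_star_graphs =
     {G. simple_graph G \<and> (\<exists>v \<in> verts G. \<forall>w \<in> verts G - {v}. {v, w} \<in> edges G)}"

lemma finite_labeled_graphs: "finite (labeled_graphs n)"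
proof (rule finite_subset)
  show "labeled_graphs n \<subseteq> {{1..n}} \<times> Pow (Pow {1..n})"
    unfolding labeled_graphs_def simple_graph_def by fastforce
qed simp

(* The maximum in the definition of max_good is attained. *)
lemma max_good_attained: "\<exists>\<G>. good_family F n \<G> \<and> card \<G> = max_good F n"
  and max_good_upper: "good_family F n \<G> \<Longrightarrow> card \<G> \<le> max_good F n"
proof -
  let ?S = "{card \<G> | \<G>. good_family F n \<G>}"
  have "?S \<subseteq> card ` Pow (labeled_graphs n)"
    by (auto simp: good_family_def)
  then have fin: "finite ?S"
    by (rule finite_subset) (simp add: finite_labeled_graphs)
  have "good_family F n {}"
    by (simp add: good_family_def)
  then have "?S \<noteq> {}"
    by blast
  from Max_in[OF fin this] show "\<exists>\<G>. good_family F n \<G> \<and> card \<G> = max_good F n"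
    unfolding max_good_def by force
  show "card \<G> \<le> max_good F n" if "good_family F n \<G>"
    unfolding max_good_def by (rule Max_ge[OF fin]) (use that in blast)
qed

end

theory Submission
  imports Defs
begin

text \<open>
  Call a vertex \<open>v\<close> a centre for two graphs \<open>G\<close>, \<open>H\<close> if \<open>G\<close> and \<open>H\<close> differ on every edge at \<open>v\<close>,
  that is, if \<open>G \<oplus> H\<close> contains the full star at \<open>v\<close>. Regard the members of a family as the
  vertices of a complete graph, and a centre for \<open>G\<close>, \<open>H\<close> as a colour of the edge \<open>GH\<close>. The idea is
  that a good family of \<open>m\<close> graphs exists if and only if the complete graph \<open>K\<^sub>m\<close> has a proper
  edge colouring with \<open>n\<close> colours.

  Upper bound. If \<open>v\<close> is a centre for \<open>G\<close>, \<open>H\<close> and for \<open>H\<close>, \<open>K\<close>, then \<open>G\<close> and \<open>K\<close> agree on all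
  edges at \<open>v\<close>. A star in \<open>G \<oplus> K\<close> reaches \<open>v\<close>, so \<open>G\<close> and \<open>K\<close> must differ on some edge at \<open>v\<close>
  unless \<open>G = K\<close>. Hence the pairs with centre \<open>v\<close> are disjoint, there are at most
  \<open>m div 2\<close> of them, and \<open>m choose 2 \<le> n * (m div 2)\<close>. This gives \<open>m \<le> n + 1\<close> when \<open>m\<close> is even
  and \<open>m \<le> n\<close> when \<open>m\<close> is odd.

  Lower bound. Given a proper edge colouring of \<open>K\<^sub>m\<close> with the colours \<open>1, \<dots>, n\<close>, it has to be
  decided for every potential edge \<open>{u, v}\<close> which of the \<open>m\<close> graphs contain it. The requirement
  is that graphs joined by an edge of colour \<open>u\<close> or \<open>v\<close> are told apart. The colour classes of
  \<open>u\<close> and \<open>v\<close> are matchings, and a union of two matchings is bipartite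
  (\<open>union_of_two_matchings_bipartite\<close>), so a choice exists, independently for each \<open>{u, v}\<close>.
  Suitable colourings come from addition modulo \<open>n\<close>.
\<close>

section \<open>Unions of two matchings are bipartite\<close>

text \<open>
  For fixed-point-free involutions \<open>f\<close> and \<open>g\<close>, the edges \<open>x, f x\<close> and \<open>x, g x\<close> form even cycles
  or infinite paths, and the rotation \<open>f \<circ> g\<close> moves two steps along them. The next lemma
  says that \<open>y\<close> and \<open>f y\<close> are not related by that rotation. The reason is that \<open>f\<close> conjugates
  \<open>f \<circ> g\<close> to its inverse, so that the midpoint of the orbit segment from \<open>y\<close> to \<open>f y\<close> would be
  fixed by \<open>f\<close> or by \<open>g\<close>; the induction approaches the midpoint from both ends.
\<close>

lemma involution_not_in_rotation_orbit:
  assumes f: "\<And>x. f (f x) = x" "\<And>x. f x \<noteq> x"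
    and g: "\<And>x. g (g x) = x" "\<And>x. g x \<noteq> x"
  shows "f y \<noteq> ((f \<circ> g) ^^ k) y"
proof (induction k arbitrary: y rule: less_induct)
  case (less k)
  show ?case
  proof
    assume eq: "f y = ((f \<circ> g) ^^ k) y"
    consider "k = 0" | "k = 1" | j where "k = Suc (Suc j)"
      by (metis One_nat_def not0_implies_Suc)
    then show False
    proof cases
      case 1
      then show False using eq f by simp
    next
      case 2
      then show False using eq f g by (metis One_nat_def comp_apply funpow_0 funpow.simps(2))
    next
      case 3
      define z where "z = f (g y)"
      have ends: "(p ^^ Suc (Suc j)) y = p ((p ^^ j) (p y))" for p :: "'a \<Rightarrow> 'a"
        by (simp add: funpow_swap1)
      have "f y = f (g (((f \<circ> g) ^^ j) z))"
        using eq ends[of "f \<circ> g"] unfolding 3 z_def by simp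
      then have "((f \<circ> g) ^^ j) z = f z"
        by (metis f(1) g(1) z_def)
      moreover have "j < k" using 3 by simp
      ultimately show False
        using less.IH[of j z] by metis
    qed
  qed
qed

text \<open>
  The orbits of the rotation \<open>f \<circ> g\<close> are the colour classes: both \<open>f\<close> and \<open>g\<close> exchange the two
  orbits of each pair, and the colouring picks one orbit from each pair.
\<close>

lemma fixpoint_free_involutions_bipartition:
  fixes f g :: "'a \<Rightarrow> 'a"
  assumes f: "\<And>x. f (f x) = x" "\<And>x. f x \<noteq> x"
    and g: "\<And>x. g (g x) = x" "\<And>x. g x \<noteq> x"
  obtains S where "\<And>x. f x \<in> S \<longleftrightarrow> x \<notin> S" "\<And>x. g x \<in> S \<longleftrightarrow> x \<notin> S"
proof -
  define h where "h = f \<circ> g"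
  \<comment> \<open>Meeting after forward steps on both sides describes the two-sided orbit without inverses.\<close>
  define orb where "orb x = {y. \<exists>j k. (h ^^ j) x = (h ^^ k) y}" for x
  have orb_refl: "x \<in> orb x" for x
    unfolding orb_def by blast
  have orb_trans: "z \<in> orb x" if "y \<in> orb x" "z \<in> orb y" for x y z
  proof -
    from that obtain j k l m where *: "(h ^^ j) x = (h ^^ k) y" "(h ^^ l) y = (h ^^ m) z"
      unfolding orb_def by blast
    have "(h ^^ (l + j)) x = (h ^^ (l + k)) y"
      by (simp add: funpow_add *(1))
    also have "\<dots> = (h ^^ (k + m)) z"
      by (simp add: add.commute[of l k] funpow_add *(2))
    finally have "(h ^^ (l + j)) x = (h ^^ (k + m)) z" .
    then show ?thesis unfolding orb_def by blast
  qed
  have orb_sym: "x \<in> orb y" if "y \<in> orb x" for x y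
    using that unfolding orb_def mem_Collect_eq by metis
  have orb_eq: "orb x = orb y" if "y \<in> orb x" for x y
    using that orb_trans orb_sym by blast
  have h_orb: "orb (h x) = orb x" for x
  proof -
    have "(h ^^ 1) x = (h ^^ 0) (h x)" by simp
    then show ?thesis using orb_eq[of "h x" x] unfolding orb_def by blast
  qed
  have conj: "(h ^^ k) (f ((h ^^ k) y)) = f y" for k y
  proof (induction k arbitrary: y)
    case (Suc k)
    have "(h ^^ Suc k) (f ((h ^^ Suc k) y)) = h ((h ^^ k) (f ((h ^^ k) (h y))))"
      by (simp add: funpow_swap1)
    also have "\<dots> = h (f (h y))" using Suc by simp
    also have "\<dots> = f y" by (simp add: h_def f(1) g(1))
    finally show ?case .
  qed simp
  have h_surj: "\<exists>y. x = (h ^^ k) y" for x k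
    by (rule exI[of _ "f ((h ^^ k) (f x))"]) (simp add: conj f(1))
  have f_orb: "orb (f x) \<noteq> orb x" for x
  proof
    assume "orb (f x) = orb x"
    then have "f x \<in> orb x" using orb_refl by blast
    then obtain j k where jk: "(h ^^ j) x = (h ^^ k) (f x)"
      unfolding orb_def by blast
    \<comment> \<open>Starting \<open>k\<close> steps earlier turns \<open>f x \<in> orb x\<close> into a forward walk from \<open>y\<close> to \<open>f y\<close>.\<close>
    obtain y where y: "x = (h ^^ k) y" using h_surj by blast
    have "(h ^^ (j + k)) y = f y"
      using jk conj by (simp add: y funpow_add)
    then show False
      using involution_not_in_rotation_orbit[OF f g, of y "j + k"] by (simp add: h_def)
  qed
  have g_orb: "orb (g x) = orb (f x)" "orb (f (g x)) = orb x" for x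
    using h_orb[of "g x"] h_orb[of x] by (simp_all add: h_def g)
  \<comment> \<open>The choice depends only on the unordered pair of orbits, so \<open>x\<close> and \<open>f x\<close> share it.\<close>
  define pick where "pick P = (SOME X. X \<in> P)" for P :: "'a set set"
  have pick: "pick {A, B} = A \<or> pick {A, B} = B" for A B
    using some_in_eq[of "{A, B}"] unfolding pick_def by blast
  define S where "S = {x. orb x = pick {orb x, orb (f x)}}"
  have swap: "f x \<in> S \<longleftrightarrow> x \<notin> S" for x
    using pick[of "orb x" "orb (f x)"] f_orb[of x]
    unfolding S_def mem_Collect_eq f(1) insert_commute[of "orb (f x)" "orb x"] by metis
  have "g x \<in> S \<longleftrightarrow> f x \<in> S" for x
    unfolding S_def mem_Collect_eq f(1) g_orb by (rule refl)
  with swap have "g x \<in> S \<longleftrightarrow> x \<notin> S" for x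
    by simp
  with swap show thesis
    by (rule that)
qed

definition matching :: "('a \<Rightarrow> 'a \<Rightarrow> bool) \<Rightarrow> bool" where
  "matching R \<longleftrightarrow> (\<forall>x y. R x y \<longrightarrow> R y x) \<and> (\<forall>x. \<not> R x x) \<and> (\<forall>x y z. R x y \<longrightarrow> R x z \<longrightarrow> y = z)"

text \<open>
  A matching corresponds to an involution whose fixed points are the unmatched vertices. They
  disappear in two disjoint copies of the vertex set when every unmatched vertex is matched with
  its own copy; a bipartition of the doubled graph restricts to one of the original graph.
\<close>

lemma union_of_two_matchings_bipartite:
  fixes R R' :: "'a \<Rightarrow> 'a \<Rightarrow> bool"
  assumes R: "matching R" and R': "matching R'"
  obtains S where "\<And>x y. R x y \<or> R' x y \<Longrightarrow> x \<in> S \<longleftrightarrow> y \<notin> S"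
proof -
  define inv_of :: "('a \<Rightarrow> 'a \<Rightarrow> bool) \<Rightarrow> 'a \<times> bool \<Rightarrow> 'a \<times> bool" where
    "inv_of Q = (\<lambda>(x, b). if \<exists>y. Q x y then (SOME y. Q x y, b) else (x, \<not> b))" for Q
  have edge: "inv_of Q (x, b) = (y, b)" if Q: "matching Q" and xy: "Q x y" for Q x y b
  proof -
    have "Q x (SOME y. Q x y)" using xy by (rule someI)
    then have "(SOME y. Q x y) = y" using Q xy unfolding matching_def by blast
    then show ?thesis using xy unfolding inv_of_def by auto
  qed
  have free: "inv_of Q (x, b) = (x, \<not> b)" if "\<nexists>y. Q x y" for Q x b
    using that unfolding inv_of_def by auto
  have inv: "inv_of Q (inv_of Q p) = p \<and> inv_of Q p \<noteq> p" if Q: "matching Q" for Q p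
  proof -
    obtain x b where p: "p = (x, b)" by fastforce
    show ?thesis
    proof (cases "\<exists>y. Q x y")
      case True
      then obtain y where xy: "Q x y" by (rule exE)
      then have "Q y x" "y \<noteq> x" using Q unfolding matching_def by blast+
      then show ?thesis
        using edge[OF Q xy] edge[OF Q, of y x] by (simp add: p)
    qed (simp add: free p)
  qed
  obtain T where T: "\<And>p. inv_of R p \<in> T \<longleftrightarrow> p \<notin> T" "\<And>p. inv_of R' p \<in> T \<longleftrightarrow> p \<notin> T"
  proof (rule fixpoint_free_involutions_bipartition)
    show "inv_of R (inv_of R p) = p" "inv_of R p \<noteq> p" for p
      using inv[OF R] by simp_all
    show "inv_of R' (inv_of R' p) = p" "inv_of R' p \<noteq> p" for p
      using inv[OF R'] by simp_all
  qed blast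
  show thesis
  proof (rule that[of "{x. (x, True) \<in> T}"])
    fix x y assume "R x y \<or> R' x y"
    then have "inv_of R (x, True) = (y, True) \<or> inv_of R' (x, True) = (y, True)"
      using edge[OF R] edge[OF R'] by blast
    then show "x \<in> {x. (x, True) \<in> T} \<longleftrightarrow> y \<notin> {x. (x, True) \<in> T}"
      using T[of "(x, True)"] by auto
  qed
qed

section \<open>Good families from proper edge colourings\<close>

text \<open>
  The sets \<open>S e\<close> of graphs containing the edge \<open>e\<close> can be chosen separately for each \<open>e\<close>. The colour
  of \<open>i, j\<close> then becomes a star centre for the graphs \<open>i\<close> and \<open>j\<close>, since every edge at this vertex
  tells the two graphs apart. As \<open>n \<ge> 2\<close>, that star has an edge, so the \<open>m\<close> graphs are distinct.
\<close>

lemma good_family_of_proper_edge_colouring: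
  fixes c :: "nat \<Rightarrow> nat \<Rightarrow> nat"
  assumes n: "n \<ge> 2"
    and range: "\<And>i j. i < m \<Longrightarrow> j < m \<Longrightarrow> c i j \<in> {1..n}"
    and sym: "\<And>i j. c i j = c j i"
    and proper: "\<And>i j k. i < m \<Longrightarrow> j < m \<Longrightarrow> k < m \<Longrightarrow> i \<noteq> j \<Longrightarrow> i \<noteq> k \<Longrightarrow> c i j = c i k \<Longrightarrow> j = k"
  shows "\<exists>\<G>. good_family spanning_star_graphs n \<G> \<and> card \<G> = m"
proof -
  define R where "R u i j \<longleftrightarrow> i < m \<and> j < m \<and> i \<noteq> j \<and> c i j = u" for u i j
  have R_sym: "R u j i" if "R u i j" for u i j
    using that sym[of j i] unfolding R_def by metis
  have R_unique: "j = k" if "R u i j" "R u i k" for u i j k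
    using that proper[of i j k] unfolding R_def by metis
  have R: "matching (R u)" for u
  proof -
    have "\<not> R u i i" for i by (simp add: R_def)
    then show ?thesis unfolding matching_def using R_sym[of u] R_unique[of u] by blast
  qed
  have "\<exists>S. \<forall>i j. i < m \<longrightarrow> j < m \<longrightarrow> i \<noteq> j \<longrightarrow> c i j \<in> e \<longrightarrow> (i \<in> S \<longleftrightarrow> j \<notin> S)"
    if card_e: "card e = 2" for e :: "nat set"
  proof -
    obtain u v where e: "e = {u, v}" using card_e by (auto simp: card_2_iff)
    obtain S where "\<And>i j. R u i j \<or> R v i j \<Longrightarrow> i \<in> S \<longleftrightarrow> j \<notin> S"
      using union_of_two_matchings_bipartite[OF R[of u] R[of v]] by blast
    then show ?thesis unfolding R_def e by blast
  qed
  then obtain S where S: "\<And>e i j. card e = 2 \<Longrightarrow> i < m \<Longrightarrow> j < m \<Longrightarrow> i \<noteq> j \<Longrightarrow> c i j \<in> e \<Longrightarrow>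
      i \<in> S e \<longleftrightarrow> j \<notin> S e"
    by metis
  define G where "G i = ({1..n}, {e. e \<subseteq> {1..n} \<and> card e = 2 \<and> i \<in> S e})" for i
  have lab: "G i \<in> labeled_graphs n" for i
    unfolding G_def labeled_graphs_def simple_graph_def by auto
  have star: "\<forall>w \<in> {1..n} - {c i j}. {c i j, w} \<in> edges (G i \<oplus> G j)"
    if ij: "i < m" "j < m" "i \<noteq> j" for i j
  proof
    fix w assume w: "w \<in> {1..n} - {c i j}"
    then have "card {c i j, w} = 2" by simp
    with S[OF this ij] w range[OF ij(1,2)]
    show "{c i j, w} \<in> edges (G i \<oplus> G j)"
      unfolding graph_symdiff_def G_def by auto
  qed
  have good: "G i \<oplus> G j \<in> spanning_star_graphs" if ij: "i < m" "j < m" "i \<noteq> j" for i j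
  proof -
    have V: "verts (G i \<oplus> G j) = {1..n}" by (simp add: graph_symdiff_def G_def)
    have "simple_graph (G i \<oplus> G j)"
      unfolding simple_graph_def graph_symdiff_def G_def by auto
    then show ?thesis
      unfolding spanning_star_graphs_def mem_Collect_eq V
      using star[OF ij] range[OF ij(1,2)] by blast
  qed
  have "inj_on G {..<m}"
  proof (rule inj_onI, rule ccontr)
    fix i j assume *: "i \<in> {..<m}" "j \<in> {..<m}" "G i = G j" "i \<noteq> j"
    obtain w where "w \<in> {1..n} - {c i j}"
      using n by (cases "c i j = 1") (auto intro: that[of 1] that[of 2])
    then have "{c i j, w} \<in> edges (G i \<oplus> G j)" using star[of i j] * by blast
    then show False using * by (simp add: graph_symdiff_def)
  qed
  then have "card (G ` {..<m}) = m" by (simp add: card_image)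
  moreover have "good_family spanning_star_graphs n (G ` {..<m})"
    unfolding good_family_def
  proof (intro conjI ballI impI)
    show "G ` {..<m} \<subseteq> labeled_graphs n" using lab by blast
    fix X Y assume "X \<in> G ` {..<m}" "Y \<in> G ` {..<m}" "X \<noteq> Y"
    then obtain i j where "X = G i" "Y = G j" "i < m" "j < m" "i \<noteq> j"
      by (elim imageE) (metis lessThan_iff)
    then show "X \<oplus> Y \<in> spanning_star_graphs" using good by simp
  qed
  ultimately show ?thesis by blast
qed

lemma mod_add_left_cancel_less:
  fixes n :: nat
  assumes "(i + j) mod n = (i + k) mod n" "j < n" "k < n"
  shows "j = k"
proof -
  have "int n dvd int (i + j) - int (i + k)"
    using assms(1) by (metis mod_eq_dvd_iff of_nat_mod)
  then have "int n dvd int j - int k" by simp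
  then have "int j mod int n = int k mod int n"
    by (simp add: mod_eq_dvd_iff)
  then show ?thesis using assms(2,3) by simp
qed

text \<open>
  The addition table modulo \<open>n\<close> is a symmetric Latin square, so its entries off the diagonal
  colour \<open>K\<^sub>n\<close> properly. One is added because the colours are the vertices \<open>1, \<dots>, n\<close>.
\<close>

lemma good_family_of_size_n:
  assumes "n \<ge> 2"
  shows "\<exists>\<G>. good_family spanning_star_graphs n \<G> \<and> card \<G> = n"
proof (rule good_family_of_proper_edge_colouring[where c = "\<lambda>i j. (i + j) mod n + 1"])
  show "j = k" if "j < n" "k < n" "(i + j) mod n + 1 = (i + k) mod n + 1" for i j k
    using that mod_add_left_cancel_less[of i j n k] by simp
  show "(i + j) mod n + 1 \<in> {1..n}" for i j
    using assms by (simp add: Suc_le_eq)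
  show "(i + j) mod n + 1 = (j + i) mod n + 1" for i j
    by (simp add: add.commute)
qed (rule assms)

text \<open>
  In the colouring of \<open>K\<^sub>n\<close> by addition modulo \<open>n\<close>, the colour given by the diagonal entry \<open>i + i\<close>
  is missing at \<open>i\<close>. For odd \<open>n\<close> these diagonal entries are all different, so they can colour
  the edges to one additional vertex, numbered \<open>n\<close>.
\<close>

lemma good_family_of_size_Suc_n:
  assumes n: "n \<ge> 2" "odd n"
  shows "\<exists>\<G>. good_family spanning_star_graphs n \<G> \<and> card \<G> = n + 1"
proof -
  define c where "c i j = (if i = n then (j + j) mod n + 1 else if j = n then (i + i) mod n + 1
      else (i + j) mod n + 1)" for i j
  show ?thesis
  proof (rule good_family_of_proper_edge_colouring[where c = c])
    show "c i j = c j i" for i j by (simp add: c_def add.commute)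
    have "x mod n + 1 \<in> {1..n}" for x using n(1) by (simp add: Suc_le_eq)
    then show "c i j \<in> {1..n}" for i j unfolding c_def by presburger
    have double: "j = k" if "(j + j) mod n = (k + k) mod n" "j < n" "k < n" for j k
    proof -
      have "int n dvd int (j + j) - int (k + k)"
        using that(1) by (metis mod_eq_dvd_iff of_nat_mod)
      also have "int (j + j) - int (k + k) = 2 * (int j - int k)" by simp
      finally have "int n dvd 2 * (int j - int k)" .
      moreover have "coprime (int n) 2" using n(2) by simp
      ultimately have "int n dvd int j - int k"
        using coprime_dvd_mult_right_iff by blast
      then have "int j mod int n = int k mod int n"
        by (simp add: mod_eq_dvd_iff)
      then show ?thesis using that(2,3) by simp
    qed
    show "j = k" if "i < n + 1" "j < n + 1" "k < n + 1" "i \<noteq> j" "i \<noteq> k" "c i j = c i k" for i j k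
    proof -
      consider "i = n" "j < n" "k < n" | "i < n" "j < n" "k < n" | "i < n" "j = n" "k = n"
        | "i < n" "j = n" "k < n" | "i < n" "j < n" "k = n"
        using \<open>i < n + 1\<close> \<open>j < n + 1\<close> \<open>k < n + 1\<close> \<open>i \<noteq> j\<close> \<open>i \<noteq> k\<close> by linarith
      then show ?thesis
      proof cases
        case 1
        then show ?thesis using \<open>c i j = c i k\<close> double[of j k] by (simp add: c_def)
      next
        case 2
        then show ?thesis
          using \<open>c i j = c i k\<close> mod_add_left_cancel_less[of i j n k] by (simp add: c_def)
      next
        case 4
        then show ?thesis
          using \<open>c i j = c i k\<close> \<open>i \<noteq> k\<close> mod_add_left_cancel_less[of i i n k] by (simp add: c_def)
      next
        case 5
        then show ?thesis
          using \<open>c i j = c i k\<close> \<open>i \<noteq> j\<close> mod_add_left_cancel_less[of i j n i] by (simp add: c_def)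
      qed simp
    qed
  qed (rule n(1))
qed

section \<open>The counting bound\<close>

lemma card_pairwise_disjoint_pairs:
  assumes "finite A" "\<And>p. p \<in> P \<Longrightarrow> p \<subseteq> A \<and> card p = 2" "pairwise disjnt P"
  shows "card P \<le> card A div 2"
proof -
  have "card (\<Union>P) = (\<Sum>p\<in>P. card p)"
    using assms by (intro card_Union_disjoint) (auto intro: finite_subset)
  also have "\<dots> = 2 * card P" using assms(2) by simp
  finally have "2 * card P = card (\<Union>P)" by simp
  also have "\<dots> \<le> card A" using assms by (intro card_mono) auto
  finally show ?thesis by simp
qed

definition star_centre :: "nat \<Rightarrow> nat graph \<Rightarrow> nat graph \<Rightarrow> nat \<Rightarrow> bool" where
  "star_centre n G H v \<longleftrightarrow>
     v \<in> {1..n} \<and> (\<forall>w \<in> {1..n} - {v}. ({v, w} \<in> edges G) \<noteq> ({v, w} \<in> edges H))"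

lemma star_centre_commute: "star_centre n G H v \<longleftrightarrow> star_centre n H G v"
  unfolding star_centre_def by auto

lemma good_family_star_centre:
  assumes "good_family spanning_star_graphs n \<G>" "G \<in> \<G>" "H \<in> \<G>" "G \<noteq> H"
  shows "\<exists>v. star_centre n G H v"
proof -
  have "verts G = {1..n}" "verts H = {1..n}" "G \<oplus> H \<in> spanning_star_graphs"
    using assms unfolding good_family_def labeled_graphs_def by auto
  then show ?thesis
    unfolding spanning_star_graphs_def graph_symdiff_def star_centre_def by auto
qed

text \<open>
  Complementing all edges at \<open>v\<close> twice restores them, so \<open>G\<close> and \<open>K\<close> agree at \<open>v\<close>, whereas any
  spanning star in \<open>G \<oplus> K\<close> uses an edge at \<open>v\<close>.
\<close>

lemma star_centre_unique_partner:
  assumes fam: "good_family spanning_star_graphs n \<G>" "G \<in> \<G>" "K \<in> \<G>"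
    and n: "n \<ge> 2"
    and v: "star_centre n G H v" "star_centre n H K v"
  shows "G = K"
proof (rule ccontr)
  assume "G \<noteq> K"
  then obtain u where u: "star_centre n G K u"
    using good_family_star_centre fam by blast
  have agree: "{v, w} \<in> edges G \<longleftrightarrow> {v, w} \<in> edges K" if "w \<in> {1..n} - {v}" for w
    using v that unfolding star_centre_def by blast
  show False
  proof (cases "u = v")
    case True
    obtain w where "w \<in> {1..n} - {v}"
      using n by (cases "v = 1") (auto intro: that[of 1] that[of 2])
    then show False using agree u True unfolding star_centre_def by blast
  next
    case False
    then have "u \<in> {1..n} - {v}" "v \<in> {1..n} - {u}"
      using u v unfolding star_centre_def by auto
    then show False
      using agree[of u] u unfolding star_centre_def by (metis insert_commute)
  qed
qed

text \<open>
  Every pair of members has a centre, and the pairs with a common centre are disjoint by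
  \<open>star_centre_unique_partner\<close>.
\<close>

lemma good_family_pairs_bound:
  assumes fam: "good_family spanning_star_graphs n \<G>" and n: "n \<ge> 2"
  shows "card \<G> choose 2 \<le> n * (card \<G> div 2)"
proof -
  have fin: "finite \<G>"
    using fam finite_labeled_graphs finite_subset unfolding good_family_def by blast
  define P where "P v = {{G, H} | G H. G \<in> \<G> \<and> H \<in> \<G> \<and> G \<noteq> H \<and> star_centre n G H v}" for v
  have bound: "card (P v) \<le> card \<G> div 2" for v
  proof (rule card_pairwise_disjoint_pairs[OF fin])
    show "p \<subseteq> \<G> \<and> card p = 2" if "p \<in> P v" for p
      using that unfolding P_def by (auto simp: card_2_iff)
    show "pairwise disjnt (P v)"
    proof (rule pairwiseI, rule ccontr)
      fix p q assume pq: "p \<in> P v" "q \<in> P v" "p \<noteq> q" "\<not> disjnt p q"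
      then obtain H where H: "H \<in> p" "H \<in> q" unfolding disjnt_def by blast
      obtain G where G: "p = {G, H}" "G \<in> \<G>" "star_centre n G H v"
        using pq(1) H(1) star_centre_commute unfolding P_def by blast
      obtain K where K: "q = {K, H}" "K \<in> \<G>" "star_centre n H K v"
        using pq(2) H(2) star_centre_commute unfolding P_def by blast
      show False
        using star_centre_unique_partner[OF fam G(2) K(2) n G(3) K(3)] G K pq by simp
    qed
  qed
  have sub: "{p. p \<subseteq> \<G> \<and> card p = 2} \<subseteq> (\<Union>v\<in>{1..n}. P v)"
  proof
    fix p assume "p \<in> {p. p \<subseteq> \<G> \<and> card p = 2}"
    then have "p \<subseteq> \<G>" "card p = 2" by simp_all
    moreover from \<open>card p = 2\<close> obtain G H where "p = {G, H}" "G \<noteq> H"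
      unfolding card_2_iff by (elim exE conjE)
    ultimately have p: "p = {G, H}" "G \<noteq> H" "G \<in> \<G>" "H \<in> \<G>"
      by simp_all
    then obtain v where "star_centre n G H v"
      using good_family_star_centre[OF fam] by blast
    then show "p \<in> (\<Union>v\<in>{1..n}. P v)"
      using p unfolding P_def star_centre_def by blast
  qed
  have "P v \<subseteq> Pow \<G>" for v unfolding P_def by blast
  then have finP: "finite (\<Union>v\<in>{1..n}. P v)"
    using fin by (meson finite_Pow_iff finite_UN_I finite_atLeastAtMost finite_subset)
  have "card \<G> choose 2 = card {p. p \<subseteq> \<G> \<and> card p = 2}"
    using n_subsets[OF fin] by simp
  also have "\<dots> \<le> card (\<Union>v\<in>{1..n}. P v)"
    using sub finP by (rule card_mono[rotated])
  also have "\<dots> \<le> (\<Sum>v\<in>{1..n}. card (P v))" by (rule card_UN_le) simp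
  also have "\<dots> \<le> (\<Sum>v\<in>{1..n}. card \<G> div 2)" by (intro sum_mono bound)
  finally show ?thesis by simp
qed

lemma choose_two_bound_parity:
  fixes m n :: nat
  assumes "m choose 2 \<le> n * (m div 2)" "n \<ge> 2"
  shows "m \<le> (if odd n then n + 1 else n)"
proof (cases "even m")
  case True
  then obtain k where k: "m = 2 * k" by blast
  \<comment> \<open>The common factor \<open>k = m div 2\<close> cancels and leaves \<open>m - 1 \<le> n\<close>.\<close>
  have "k * (2 * k - 1) \<le> k * n"
    using assms(1) by (simp add: k choose_two mult.assoc mult.commute)
  then have "m \<le> n + 1" using k by (cases "k = 0") auto
  moreover have "m \<noteq> n + 1" if "even n" using that True by auto
  ultimately show ?thesis by fastforce
next
  case False
  then obtain k where k: "m = 2 * k + 1" using oddE by blast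
  have "m choose 2 = k * m" by (simp add: k choose_two)
  then have "k * m \<le> k * n"
    using assms(1) by (simp add: k mult.commute)
  then have "k = 0 \<or> m \<le> n" by auto
  then have "m \<le> n" using k assms(2) by auto
  then show ?thesis by simp
qed

theorem theorem7:
  fixes n :: nat
  assumes "n \<ge> 2"
  shows "max_good spanning_star_graphs n = (if odd n then n + 1 else n)"
proof (rule antisym)
  obtain \<G> where "good_family spanning_star_graphs n \<G>" "card \<G> = max_good spanning_star_graphs n"
    using max_good_attained by blast
  then show "max_good spanning_star_graphs n \<le> (if odd n then n + 1 else n)"
    using choose_two_bound_parity[OF good_family_pairs_bound] assms by metis
next
  show "(if odd n then n + 1 else n) \<le> max_good spanning_star_graphs n"
    using good_family_of_size_n good_family_of_size_Suc_n max_good_upper assms by metis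
qed

end
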